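(* Let $(T,\mathcal J)$ be an $\mathbb N^n$-pair generated by a tree $(V,\Gamma)$ with weight $((T_0,\mathcal J_0),\boldsymbol\delta,\boldsymbol\alpha,\Phi)$ and tops $x_1,\dots,x_n$. Then, for every $v\in V$, the power series $P_v(x)$ and $Q_v(x)$ defined in the context are binary power series (all coefficients lie in $\{0,1\}$), and $$T(x)=\prod_{v\in V}P_v(x),\qquad \mathcal J(x)=\prod_{v\in V}Q_v(x).$$
   Context: $\mathbb N=\mathbb Z_{\ge 0}$. An $\mathbb N^n$-pair is a pair $(T,\mathcal J)$ of subsets of $\mathbb N^n$ such that every element of $\mathbb N^n$ is uniquely $t+s$ with $t\in T$, $s\in\mathcal J$. For $A\subset\mathbb N^n$ put $A(x)=\sum_{a\in A}x^a$, $x^a=x_1^{a_1}\cdots x_n^{a_n}$; sets are identified with these power series. For $\boldsymbol a\in(\mathbb N\setminus\{0\})^p$, $L_{\boldsymbol a}=\mathbb N^p\setminus(\mathbb N^p+\boldsymbol a)$, and $L_{\boldsymbol a}^{\delta}(\cdot)$ denotes the $\delta$-th power of its power series ($\delta\in\{0,1\}$). An interval pair of size $N\ge1$ is a pair $(C,D)$ of subsets of $\{0,\dots,N-1\}$ such that $C+D=\{0,\dots,N-1\}$ with every element uniquely of the form $c+d$, $c\in C$, $d\in D$. Weighted trees. Let $(V,\Gamma)$ be a finite tree with root $\phi$. Offspring, parent and ancestor are understood with respect to the root; a top is a node without offspring, and $V_0$ is the set of tops. Every non-top node is assumed to have at least two offspring. (The tree $\{\phi\}$ has the single top $\phi$.)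 A weight is a quadruple $((T_0,\mathcal J_0),\boldsymbol\delta,\boldsymbol\alpha,\Phi)$, where $(T_0,\mathcal J_0)$ is an $\mathbb N$-pair, $\boldsymbol\delta:V\setminus V_0\to\{0,1\}$, $\boldsymbol\alpha:V\setminus\{\phi\}\to\mathbb N\setminus\{0\}$, $\Phi:V\setminus\{\phi\}\to\{\text{interval pairs}\}$, and, if $\phi$ is not a top, $\boldsymbol\delta_\phi=1$ when $T_0=\{0\}$ and $\boldsymbol\delta_\phi=0$ when $\mathcal J_0=\{0\}$. Generated pair. Nodes are used as variables; the tops are $x_1,\dots,x_n$. The generated pair is defined by induction on $\#V-\#V_0$. If $V=\{\phi\}$, it is $(T_0,\mathcal J_0)$. Otherwise choose any non-top node $z_1$ all of whose offspring are tops; after reordering let these offspring be $x_1,\dots,x_p$. Delete the nodes $x_1,\dots,x_p$ and the edges joining them to $z_1$; the resulting tree has tops $z_1,x_{p+1},\dots,x_n$ and, with the restricted weight, generates a pair $(\widetilde T,\widetilde{\mathcal J})$ in the variables $(z_1,\bar x)$, $\bar x=(x_{p+1},\dots,x_n)$. Let $\delta=\boldsymbol\delta_{z_1}$, $a_j=\boldsymbol\alpha_{x_j}$, $\boldsymbol a=(a_1,\dots,a_p)$, $\Phi_{x_j}=(C_j,D_j)$ of size $N_j$. Then $$T(x)=\Big(\prod_{j=1}^pC_j(x_j)\Big)L_{\boldsymbol a}^{\delta}(x_1^{N_1},\dots,x_p^{N_p})\,\widetilde T\Big(\prod_{j=1}^px_j^{a_jN_j},\bar x\Big),$$ $$\mathcal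 J(x)=\Big(\prod_{j=1}^pD_j(x_j)\Big)L_{\boldsymbol a}^{1-\delta}(x_1^{N_1},\dots,x_p^{N_p})\,\widetilde{\mathcal J}\Big(\prod_{j=1}^px_j^{a_jN_j},\bar x\Big).$$ The map $\mu$. For $v\in V$ and a top $x^*$: if $v$ is an ancestor of $x^*$ and $v,v_1,\dots,v_k=x^*$ is the path from $v$ to $x^*$, put $\mu(v,x^* )=\prod_{j=1}^kc_jM_j$ with $c_j=\boldsymbol\alpha_{v_j}$ and $M_j$ the size of $\Phi_{v_j}$; put $\mu(v,x^* )=1$ if $v=x^*$, and $\mu(v,x^* )=0$ otherwise. Let $\mu(v)=(\mu(v,x_1),\dots,\mu(v,x_n))$. The series $P_v,Q_v$. Write $\Phi_v=(C_v,D_v)$ for $v\ne\phi$ and $C_\phi=T_0$, $D_\phi=\mathcal J_0$. If $v$ is a top, $P_v(x)=C_v(v)$ and $Q_v(x)=D_v(v)$ (here $v$ is one of the variables $x_i$; if $V=\{\phi\}$ this reads $P_\phi(\phi)=T_0(\phi)$, $Q_\phi(\phi)=\mathcal J_0(\phi)$). If $v$ is not a top, with offspring $z_1,\dots,z_m$, let $\boldsymbol b=(\boldsymbol\alpha_{z_1},\dots,\boldsymbol\alpha_{z_m})$, let $M_j$ be the size of $\Phi_{z_j}$, and put $$P_v(x)=C_v(x^{\mu(v)})\,L_{\boldsymbol b}^{\boldsymbol\delta_v}(x^{M_1\mu(z_1)},\dots,x^{M_m\mu(z_m)}),$$ $$Q_v(x)=D_v(x^{\mu(v)})\,L_{\boldsymbol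 b}^{1-\boldsymbol\delta_v}(x^{M_1\mu(z_1)},\dots,x^{M_m\mu(z_m)}).$$ *)

theory Defs
  imports "HOL-Library.Poly_Mapping"
begin

text \<open>
  Exponent vectors are finitely supported functions from variables to \<open>nat\<close>; for a finite set
  \<open>I\<close> of variables, the vectors with support in \<open>I\<close> play the role of \<open>\<nat>\<^sup>I\<close>.
  A power series is an arbitrary family of integer coefficients indexed by exponent vectors.
\<close>

typedef 'v mfps = "UNIV :: (('v \<Rightarrow>\<^sub>0 nat) \<Rightarrow> int) set"
  morphisms coeff Abs_mfps ..

setup_lifting type_definition_mfps

lemma mfps_eqI: "(\<And>u. coeff f u = coeff g u) \<Longrightarrow> f = g"
  by (simp add: coeff_inject[symmetric] fun_eq_iff)

lemma finite_splittings: "finite {(a, b). a + b = (u :: 'v \<Rightarrow>\<^sub>0 nat)}"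
proof -
  let ?F = "{f :: 'v \<Rightarrow> nat. \<forall>i.
      (i \<in> Poly_Mapping.keys u \<longrightarrow> f i \<in> (\<Union>j \<in> Poly_Mapping.keys u. {..Poly_Mapping.lookup u j})) \<and>
      (i \<notin> Poly_Mapping.keys u \<longrightarrow> f i = 0)}"
  have fin: "finite ?F"
    by (rule finite_set_of_finite_funs) auto
  have part: "{a. \<exists>b. a + b = u} \<subseteq> Abs_poly_mapping ` ?F"
  proof
    fix a assume "a \<in> {a. \<exists>b. a + b = u}"
    then obtain b where u: "u = a + b" by auto
    have "Poly_Mapping.lookup a i \<le> Poly_Mapping.lookup u i" for i by (simp add: u lookup_add)
    moreover have "Poly_Mapping.lookup a i = 0" if "i \<notin> Poly_Mapping.keys u" for i
      using that calculation[of i] by (simp add: in_keys_iff)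
    ultimately have "Poly_Mapping.lookup a \<in> ?F" by (simp, blast)
    then show "a \<in> Abs_poly_mapping ` ?F" 
      by (rule image_eqI[rotated]) (simp add: lookup_inverse)
  qed
  then have fin1: "finite {a. \<exists>b. a + b = u}" using fin finite_subset by blast
  have "{(a, b). a + b = u} \<subseteq> {a. \<exists>b. a + b = u} \<times> {a. \<exists>b. a + b = u}"
    using add.commute by blast
  then show ?thesis using fin1 by (meson finite_SigmaI finite_subset)
qed

instantiation mfps :: (type) comm_ring_1
begin

lift_definition zero_mfps :: "'v mfps" is "\<lambda>_. 0" .
lift_definition one_mfps :: "'v mfps" is "\<lambda>u. if u = 0 then 1 else 0" .
lift_definition plus_mfps :: "'v mfps \<Rightarrow> 'v mfps \<Rightarrow> 'v mfps" is "\<lambda>f g u. f u + g u" .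
lift_definition uminus_mfps :: "'v mfps \<Rightarrow> 'v mfps" is "\<lambda>f u. - f u" .
lift_definition minus_mfps :: "'v mfps \<Rightarrow> 'v mfps \<Rightarrow> 'v mfps" is "\<lambda>f g u. f u - g u" .
lift_definition times_mfps :: "'v mfps \<Rightarrow> 'v mfps \<Rightarrow> 'v mfps"
  is "\<lambda>f g u. \<Sum>(a, b) \<in> {(a, b). a + b = u}. f a * g b" .

instance
proof
  fix f g h :: "'v mfps"
  show "f * g = g * f"
  proof (rule mfps_eqI)
    fix u
    show "coeff (f * g) u = coeff (g * f) u"
      unfolding times_mfps.rep_eq
      by (rule sum.reindex_bij_witness[where i = "\<lambda>(a, b). (b, a)" and j = "\<lambda>(a, b). (b, a)"])
        (auto simp: add.commute mult.commute)
  qed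
  show "f * g * h = f * (g * h)"
  proof (rule mfps_eqI)
    fix u
    let ?S = "\<lambda>u. {(a, b). a + b = (u :: 'v \<Rightarrow>\<^sub>0 nat)}"
    have "coeff (f * g * h) u
        = (\<Sum>p \<in> ?S u. \<Sum>q \<in> ?S (fst p). coeff f (fst q) * coeff g (snd q) * coeff h (snd p))"
      by (simp add: times_mfps.rep_eq case_prod_beta sum_distrib_right)
    also have "\<dots> = (\<Sum>(p, q) \<in> Sigma (?S u) (\<lambda>p. ?S (fst p)).
        coeff f (fst q) * coeff g (snd q) * coeff h (snd p))"
      by (rule sum.Sigma) (auto intro: finite_splittings)
    also have "\<dots> = (\<Sum>(p, q) \<in> Sigma (?S u) (\<lambda>p. ?S (snd p)).
        coeff f (fst p) * (coeff g (fst q) * coeff h (snd q)))"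
      by (rule sum.reindex_bij_witness[where
            i = "\<lambda>((a, d), (b, c)). ((a + b, c), (a, b))" and
            j = "\<lambda>((d, c), (a, b)). ((a, b + c), (b, c))"])
        (auto simp: add.assoc mult.assoc)
    also have "\<dots> = (\<Sum>p \<in> ?S u. \<Sum>q \<in> ?S (snd p).
        coeff f (fst p) * (coeff g (fst q) * coeff h (snd q)))"
      by (rule sum.Sigma[symmetric]) (auto intro: finite_splittings)
    also have "\<dots> = coeff (f * (g * h)) u"
      by (simp add: times_mfps.rep_eq case_prod_beta sum_distrib_left)
    finally show "coeff (f * g * h) u = coeff (f * (g * h)) u" .
  qed
  show "1 * f = f"
  proof (rule mfps_eqI)
    fix u
    have "coeff (1 * f) u
        = (\<Sum>(a, b) \<in> {(0 :: 'v \<Rightarrow>\<^sub>0 nat, u)}. (if a = 0 then 1 else 0) * coeff f b)"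
      unfolding times_mfps.rep_eq one_mfps.rep_eq
    proof (rule sum.mono_neutral_right)
      show "finite {(a, b). a + b = u}" by (rule finite_splittings)
    qed (auto split: if_splits)
    then show "coeff (1 * f) u = coeff f u" by simp
  qed
  show "(f + g) * h = f * h + g * h"
    by (rule mfps_eqI)
      (simp add: times_mfps.rep_eq plus_mfps.rep_eq case_prod_beta distrib_right sum.distrib)
  have "coeff (0 :: 'v mfps) 0 \<noteq> coeff (1 :: 'v mfps) 0"
    by (simp add: zero_mfps.rep_eq one_mfps.rep_eq)
  then show "(0 :: 'v mfps) \<noteq> 1" by metis
qed (rule mfps_eqI; simp add: zero_mfps.rep_eq plus_mfps.rep_eq uminus_mfps.rep_eq
      minus_mfps.rep_eq)+

end

definition binary_mfps :: "'v mfps \<Rightarrow> bool" where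
  "binary_mfps f \<longleftrightarrow> (\<forall>u. coeff f u \<in> {0, 1})"

text \<open>
  The series \<open>\<Sum>i\<in>I. x^(m i)\<close>. It is only meaningful if each exponent vector is attained finitely
  often; the coefficient at an exponent vector attained infinitely often is 0.
\<close>

definition monomial_sum :: "'i set \<Rightarrow> ('i \<Rightarrow> ('v \<Rightarrow>\<^sub>0 nat)) \<Rightarrow> 'v mfps" where
  "monomial_sum I m = Abs_mfps (\<lambda>u. int (card {i \<in> I. m i = u}))"

definition series :: "('v \<Rightarrow>\<^sub>0 nat) set \<Rightarrow> 'v mfps" where
  "series A = monomial_sum A (\<lambda>a. a)"

definition scale :: "nat \<Rightarrow> ('v \<Rightarrow>\<^sub>0 nat) \<Rightarrow> ('v \<Rightarrow>\<^sub>0 nat)" where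
  "scale c m = Poly_Mapping.map (\<lambda>k. c * k) m"

text \<open>
  Substitution of monomials: for a set \<open>C\<close> of natural numbers, \<open>subst1 C m\<close> is \<open>C(x^m)\<close>; for a set
  \<open>A\<close> of exponent vectors, \<open>subst A m\<close> is the series \<open>A\<close> with \<open>x^(m i)\<close> substituted for
  each variable \<open>i\<close>.
\<close>

definition subst1 :: "nat set \<Rightarrow> ('v \<Rightarrow>\<^sub>0 nat) \<Rightarrow> 'v mfps" where
  "subst1 C m = monomial_sum C (\<lambda>c. scale c m)"

definition subst :: "('w \<Rightarrow>\<^sub>0 nat) set \<Rightarrow> ('w \<Rightarrow> ('v \<Rightarrow>\<^sub>0 nat)) \<Rightarrow> 'v mfps" where
  "subst A m = monomial_sum A (\<lambda>a. \<Sum>i \<in> Poly_Mapping.keys a. scale (Poly_Mapping.lookup a i) (m i))"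

abbreviation var :: "'v \<Rightarrow> ('v \<Rightarrow>\<^sub>0 nat)" where
  "var v \<equiv> Poly_Mapping.single v 1"

definition vector :: "'v set \<Rightarrow> ('v \<Rightarrow> nat) \<Rightarrow> ('v \<Rightarrow>\<^sub>0 nat)" where
  "vector I a = (\<Sum>i \<in> I. Poly_Mapping.single i (a i))"

text \<open>\<open>corner I a\<close> is the set \<open>L\<^sub>a = \<nat>\<^sup>I - (\<nat>\<^sup>I + a)\<close>.\<close>

definition corner :: "'v set \<Rightarrow> ('v \<Rightarrow> nat) \<Rightarrow> ('v \<Rightarrow>\<^sub>0 nat) set" where
  "corner I a = {e. Poly_Mapping.keys e \<subseteq> I} - {e + vector I a | e. Poly_Mapping.keys e \<subseteq> I}"

text \<open>\<open>bij_betw\<close> says that the sums \<open>t + s\<close> make up the whole set and are pairwise different.\<close>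

definition nat_pair :: "nat set \<times> nat set \<Rightarrow> bool" where
  "nat_pair P \<longleftrightarrow> bij_betw (\<lambda>(t, s). t + s) (fst P \<times> snd P) UNIV"

definition interval_pair_of_size :: "nat \<Rightarrow> nat set \<times> nat set \<Rightarrow> bool" where
  "interval_pair_of_size N P \<longleftrightarrow> N \<ge> 1 \<and> fst P \<subseteq> {0..<N} \<and> snd P \<subseteq> {0..<N} \<and>
     bij_betw (\<lambda>(c, d). c + d) (fst P \<times> snd P) {0..<N}"

definition interval_pair :: "nat set \<times> nat set \<Rightarrow> bool" where
  "interval_pair P \<longleftrightarrow> (\<exists>N. interval_pair_of_size N P)"

definition pair_size :: "nat set \<times> nat set \<Rightarrow> nat" where
  "pair_size P = (THE N. interval_pair_of_size N P)"

text \<open>The edges of a rooted tree are directed away from the root: \<open>(u, v) \<in> \<Gamma>\<close> iff \<open>v\<close> is an offspring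
  of \<open>u\<close>.\<close>

definition rooted_tree :: "'v set \<Rightarrow> ('v \<times> 'v) set \<Rightarrow> 'v \<Rightarrow> bool" where
  "rooted_tree V \<Gamma> \<phi> \<longleftrightarrow> finite V \<and> \<phi> \<in> V \<and> \<Gamma> \<subseteq> V \<times> V \<and>
     (\<forall>v \<in> V. (\<phi>, v) \<in> \<Gamma>\<^sup>*) \<and>
     (\<forall>u. (u, \<phi>) \<notin> \<Gamma>) \<and>
     (\<forall>v \<in> V - {\<phi>}. \<exists>!u. (u, v) \<in> \<Gamma>)"

definition offspring :: "('v \<times> 'v) set \<Rightarrow> 'v \<Rightarrow> 'v set" where
  "offspring \<Gamma> v = {w. (v, w) \<in> \<Gamma>}"

definition ancestor :: "('v \<times> 'v) set \<Rightarrow> 'v \<Rightarrow> 'v \<Rightarrow> bool" where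
  "ancestor \<Gamma> u v \<longleftrightarrow> (u, v) \<in> \<Gamma>\<^sup>+"

definition tops :: "'v set \<Rightarrow> ('v \<times> 'v) set \<Rightarrow> 'v set" where
  "tops V \<Gamma> = {v \<in> V. offspring \<Gamma> v = {}}"

text \<open>The four components of a weight are total functions on the type of nodes; values outside the
  domains given in \<open>tree_weight\<close> are never used. In particular, restricting a weight to a smaller
  tree does not change it.\<close>

record 'v weight =
  root_pair :: "nat set \<times> nat set"
  delta :: "'v \<Rightarrow> nat"
  alpha :: "'v \<Rightarrow> nat"
  Phi :: "'v \<Rightarrow> nat set \<times> nat set"

definition tree_weight :: "'v set \<Rightarrow> ('v \<times> 'v) set \<Rightarrow> 'v \<Rightarrow> 'v weight \<Rightarrow> bool" where
  "tree_weight V \<Gamma> \<phi> W \<longleftrightarrow>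
     nat_pair (root_pair W) \<and>
     (\<forall>v \<in> V - tops V \<Gamma>. delta W v \<in> {0, 1}) \<and>
     (\<forall>v \<in> V - {\<phi>}. alpha W v > 0) \<and>
     (\<forall>v \<in> V - {\<phi>}. interval_pair (Phi W v)) \<and>
     (\<phi> \<notin> tops V \<Gamma> \<longrightarrow>
        (fst (root_pair W) = {0} \<longrightarrow> delta W \<phi> = 1) \<and>
        (snd (root_pair W) = {0} \<longrightarrow> delta W \<phi> = 0))"

definition weighted_tree :: "'v set \<Rightarrow> ('v \<times> 'v) set \<Rightarrow> 'v \<Rightarrow> 'v weight \<Rightarrow> bool" where
  "weighted_tree V \<Gamma> \<phi> W \<longleftrightarrow> rooted_tree V \<Gamma> \<phi> \<and>
     (\<forall>v \<in> V - tops V \<Gamma>. card (offspring \<Gamma> v) \<ge> 2) \<and> tree_weight V \<Gamma> \<phi> W"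

abbreviation node_size :: "'v weight \<Rightarrow> 'v \<Rightarrow> nat" where
  "node_size W v \<equiv> pair_size (Phi W v)"

text \<open>
  In \<open>collapse W z X\<close> the variable \<open>z\<close> is replaced by the product of the \<open>x^(a\<^sub>x N\<^sub>x)\<close> over the
  offspring \<open>x\<close> of \<open>z\<close>; every other variable is kept.
\<close>

definition collapse :: "'v weight \<Rightarrow> 'v \<Rightarrow> 'v set \<Rightarrow> 'v \<Rightarrow> ('v \<Rightarrow>\<^sub>0 nat)" where
  "collapse W z X y = (if y = z then vector X (\<lambda>x. alpha W x * node_size W x) else var y)"

text \<open>The subsets \<open>T\<close> and \<open>J\<close> of \<open>\<nat>\<^sup>n\<close> are determined by their series, since \<open>series\<close> is injective.\<close>

inductive generates ::
  "'v \<Rightarrow> 'v weight \<Rightarrow> 'v set \<Rightarrow> ('v \<times> 'v) set \<Rightarrow> ('v \<Rightarrow>\<^sub>0 nat) set \<Rightarrow> ('v \<Rightarrow>\<^sub>0 nat) set \<Rightarrow> bool"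
  for \<phi> :: 'v and W :: "'v weight"
where
  root: "generates \<phi> W {\<phi>} {}
           (Poly_Mapping.single \<phi> ` fst (root_pair W)) (Poly_Mapping.single \<phi> ` snd (root_pair W))"
| step: "\<lbrakk> z \<in> V; X = offspring \<Gamma> z; X \<noteq> {}; X \<subseteq> tops V \<Gamma>;
           generates \<phi> W (V - X) (\<Gamma> - {z} \<times> X) T' J';
           series T =
             (\<Prod>x \<in> X. subst1 (fst (Phi W x)) (var x))
             * subst (corner X (alpha W)) (\<lambda>x. scale (node_size W x) (var x)) ^ delta W z
             * subst T' (collapse W z X);
           series J =
             (\<Prod>x \<in> X. subst1 (snd (Phi W x)) (var x))
             * subst (corner X (alpha W)) (\<lambda>x. scale (node_size W x) (var x)) ^ (1 - delta W z)
             * subst J' (collapse W z X) \<rbrakk>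
         \<Longrightarrow> generates \<phi> W V \<Gamma> T J"

text \<open>The path \<open>v, v\<^sub>1, \<dots>, v\<^sub>k = x\<close> is represented by the list \<open>[v\<^sub>1, \<dots>, v\<^sub>k]\<close>.\<close>

definition tree_path :: "('v \<times> 'v) set \<Rightarrow> 'v \<Rightarrow> 'v list \<Rightarrow> 'v \<Rightarrow> bool" where
  "tree_path \<Gamma> v vs x \<longleftrightarrow> successively (\<lambda>a b. (a, b) \<in> \<Gamma>) (v # vs) \<and> last (v # vs) = x"

definition mu_entry :: "('v \<times> 'v) set \<Rightarrow> 'v weight \<Rightarrow> 'v \<Rightarrow> 'v \<Rightarrow> nat" where
  "mu_entry \<Gamma> W v x =
     (if ancestor \<Gamma> v x
      then prod_list (map (\<lambda>u. alpha W u * node_size W u) (THE vs. tree_path \<Gamma> v vs x))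
      else if v = x then 1 else 0)"

definition mu :: "'v set \<Rightarrow> ('v \<times> 'v) set \<Rightarrow> 'v weight \<Rightarrow> 'v \<Rightarrow> ('v \<Rightarrow>\<^sub>0 nat)" where
  "mu V \<Gamma> W v = vector (tops V \<Gamma>) (mu_entry \<Gamma> W v)"

definition node_pair :: "'v \<Rightarrow> 'v weight \<Rightarrow> 'v \<Rightarrow> nat set \<times> nat set" where
  "node_pair \<phi> W v = (if v = \<phi> then root_pair W else Phi W v)"

definition P_series :: "'v set \<Rightarrow> ('v \<times> 'v) set \<Rightarrow> 'v \<Rightarrow> 'v weight \<Rightarrow> 'v \<Rightarrow> 'v mfps" where
  "P_series V \<Gamma> \<phi> W v =
     (if v \<in> tops V \<Gamma> then subst1 (fst (node_pair \<phi> W v)) (var v)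
      else subst1 (fst (node_pair \<phi> W v)) (mu V \<Gamma> W v)
        * subst (corner (offspring \<Gamma> v) (alpha W)) (\<lambda>z. scale (node_size W z) (mu V \<Gamma> W z))
            ^ delta W v)"

definition Q_series :: "'v set \<Rightarrow> ('v \<times> 'v) set \<Rightarrow> 'v \<Rightarrow> 'v weight \<Rightarrow> 'v \<Rightarrow> 'v mfps" where
  "Q_series V \<Gamma> \<phi> W v =
     (if v \<in> tops V \<Gamma> then subst1 (snd (node_pair \<phi> W v)) (var v)
      else subst1 (snd (node_pair \<phi> W v)) (mu V \<Gamma> W v)
        * subst (corner (offspring \<Gamma> v) (alpha W)) (\<lambda>z. scale (node_size W z) (mu V \<Gamma> W z))
            ^ (1 - delta W v))"

end

(* Substituting monomials by a finite-to-one exponent map is a ring homomorphism on power series.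
   Removing the offspring of z substitutes x^(mu z) for z, and this substitution takes the vectors mu
   of the pruned tree to those of the full tree, since mu v is the sum of alpha_w M_w mu(w) over the
   offspring w of v. So it takes P_v of the pruned tree to P_v for v distinct from z, and the factors
   left over are P_z and the P_x of the removed tops x. P_v is binary because siblings have mu-vectors
   of disjoint support and every exponent is c b + e in at most one way with e in the corner L_b. *)

theory Submission
  imports Defs
begin

section \<open>Substitution of monomials\<close>

lemma lookup_scale [simp]: "Poly_Mapping.lookup (scale c m) k = c * Poly_Mapping.lookup m k"
  by (simp add: scale_def Poly_Mapping.map.rep_eq when_def)

lemma scale_add: "scale c (a + b) = scale c a + scale c b"
  by (rule poly_mapping_eqI) (simp add: lookup_add algebra_simps)

lemma scale_add_left: "scale (c + d) a = scale c a + scale d a"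
  by (rule poly_mapping_eqI) (simp add: lookup_add algebra_simps)

lemma scale_Suc: "scale (Suc c) a = scale c a + a"
  by (rule poly_mapping_eqI) (simp add: lookup_add)

lemma scale_zero [simp]: "scale 0 a = 0" "scale c 0 = 0"
  by (rule poly_mapping_eqI, simp)+

lemma scale_one [simp]: "scale (Suc 0) a = a"
  by (rule poly_mapping_eqI) simp

lemma scale_scale: "scale c (scale d a) = scale (c * d) a"
  by (rule poly_mapping_eqI) (simp add: algebra_simps)

lemma scale_single: "scale c (Poly_Mapping.single v k) = Poly_Mapping.single v (c * k)"
  by (rule poly_mapping_eqI) (simp add: lookup_single when_def)

lemma single_inject [simp]: "Poly_Mapping.single v k = Poly_Mapping.single v l \<longleftrightarrow> k = l"
  by (metis lookup_single_eq)

lemma single_eq_0_iff [simp]: "Poly_Mapping.single v k = 0 \<longleftrightarrow> k = 0"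
  by (metis single_inject single_zero)

lemma inj_scale: "m \<noteq> 0 \<Longrightarrow> inj (\<lambda>c. scale c m)"
  by (rule injI) (metis lookup_scale mult_cancel2 poly_mapping_eqI lookup_zero)

text \<open>Every such \<open>a\<close> is the first part of the splitting
  \<open>a + (w - a) = w\<close>, and \<open>w\<close> has only finitely many splittings.\<close>

lemma finite_bounded_poly_mappings:
  fixes w :: "'v \<Rightarrow>\<^sub>0 nat"
  shows "finite {a. \<forall>k. Poly_Mapping.lookup a k \<le> Poly_Mapping.lookup w k}"
proof -
  have "{a. \<forall>k. Poly_Mapping.lookup a k \<le> Poly_Mapping.lookup w k} \<subseteq> fst ` {(a, b). a + b = w}"
  proof
    fix a assume "a \<in> {a. \<forall>k. Poly_Mapping.lookup a k \<le> Poly_Mapping.lookup w k}"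
    then have "a + (w - a) = w"
      by (intro poly_mapping_eqI) (simp add: lookup_add lookup_minus)
    then show "a \<in> fst ` {(a, b). a + b = w}" by force
  qed
  then show ?thesis using finite_splittings finite_subset by blast
qed

lemma lookup_vector:
  "finite I \<Longrightarrow> Poly_Mapping.lookup (vector I a) k = (if k \<in> I then a k else 0)"
  by (simp add: vector_def lookup_sum lookup_single when_def)

text \<open>Homomorphisms of additive monoids: on exponents, every substitution of monomials acts in
  this way.\<close>

definition additive_exp :: "(('w \<Rightarrow>\<^sub>0 nat) \<Rightarrow> ('v \<Rightarrow>\<^sub>0 nat)) \<Rightarrow> bool" where
  "additive_exp h \<longleftrightarrow> h 0 = 0 \<and> (\<forall>a b. h (a + b) = h a + h b)"

lemma additive_exp_add: "additive_exp h \<Longrightarrow> h (a + b) = h a + h b"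
  by (simp add: additive_exp_def)

lemma additive_exp_sum: "additive_exp h \<Longrightarrow> h (sum f A) = (\<Sum>i\<in>A. h (f i))"
  by (induction A rule: infinite_finite_induct) (auto simp: additive_exp_def)

lemma additive_exp_scale: "additive_exp h \<Longrightarrow> h (scale c a) = scale c (h a)"
proof (induction c)
  case (Suc c)
  then show ?case by (simp add: scale_Suc additive_exp_def)
qed (simp add: additive_exp_def)

text \<open>The exponent vector of the monomial that results from \<open>x^a\<close> when
  \<open>x^(m i)\<close> is put for each variable \<open>i\<close>; naming it lets
  \<open>subst\<close> be treated as an additive map.\<close>

definition monomial_subst :: "('w \<Rightarrow> ('v \<Rightarrow>\<^sub>0 nat)) \<Rightarrow> ('w \<Rightarrow>\<^sub>0 nat) \<Rightarrow> ('v \<Rightarrow>\<^sub>0 nat)" where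
  "monomial_subst m a = (\<Sum>i \<in> Poly_Mapping.keys a. scale (Poly_Mapping.lookup a i) (m i))"

lemma monomial_subst_superset:
  assumes "finite I" "Poly_Mapping.keys a \<subseteq> I"
  shows "monomial_subst m a = (\<Sum>i\<in>I. scale (Poly_Mapping.lookup a i) (m i))"
  unfolding monomial_subst_def using assms
  by (intro sum.mono_neutral_left) (auto simp: in_keys_iff)

lemma additive_monomial_subst: "additive_exp (monomial_subst m)"
proof -
  have "monomial_subst m (a + b) = monomial_subst m a + monomial_subst m b" for a b
  proof -
    let ?I = "Poly_Mapping.keys a \<union> Poly_Mapping.keys b"
    have "finite ?I" "Poly_Mapping.keys a \<subseteq> ?I" "Poly_Mapping.keys b \<subseteq> ?I"
      "Poly_Mapping.keys (a + b) \<subseteq> ?I"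
      by (auto simp: in_keys_iff lookup_add)
    then show ?thesis
      by (simp add: monomial_subst_superset[of ?I] lookup_add scale_add_left sum.distrib)
  qed
  then show ?thesis by (simp add: additive_exp_def monomial_subst_def)
qed

lemma monomial_subst_single [simp]:
  "monomial_subst m (Poly_Mapping.single i k) = scale k (m i)"
  by (subst monomial_subst_superset[of "{i}"]) auto

lemma monomial_subst_cong:
  "(\<And>i. i \<in> Poly_Mapping.keys a \<Longrightarrow> m i = m' i) \<Longrightarrow> monomial_subst m a = monomial_subst m' a"
  by (simp add: monomial_subst_def)

lemma monomial_subst_vector:
  "monomial_subst m (vector I a) = (\<Sum>i\<in>I. scale (a i) (m i))"
  by (simp add: vector_def additive_exp_sum[OF additive_monomial_subst])

lemma additive_exp_monomial_subst:
  "additive_exp h \<Longrightarrow> h (monomial_subst m a) = monomial_subst (\<lambda>i. h (m i)) a"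
  by (simp add: monomial_subst_def additive_exp_sum additive_exp_scale)

text \<open>Every \<open>m x\<close> has a key \<open>k\<close> that no other \<open>m i\<close>
  shares. The coordinate \<open>k\<close> of the image is then the coordinate \<open>x\<close> of
  the argument times a positive constant, and determines it.\<close>

lemma inj_on_monomial_subst:
  assumes nz: "\<And>i. i \<in> X \<Longrightarrow> m i \<noteq> 0"
    and disj: "\<And>i j. i \<in> X \<Longrightarrow> j \<in> X \<Longrightarrow> i \<noteq> j \<Longrightarrow>
      Poly_Mapping.keys (m i) \<inter> Poly_Mapping.keys (m j) = {}"
  shows "inj_on (monomial_subst m) {a. Poly_Mapping.keys a \<subseteq> X}"
proof (rule inj_onI)
  fix a b assume ab: "a \<in> {a. Poly_Mapping.keys a \<subseteq> X}" "b \<in> {a. Poly_Mapping.keys a \<subseteq> X}"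
    and eq: "monomial_subst m a = monomial_subst m b"
  show "a = b"
  proof (rule poly_mapping_eqI)
    fix x
    show "Poly_Mapping.lookup a x = Poly_Mapping.lookup b x"
    proof (cases "x \<in> X")
      case True
      then obtain k where k: "k \<in> Poly_Mapping.keys (m x)"
        using nz[of x] by (metis keys_eq_empty equals0I)
      have "Poly_Mapping.lookup (monomial_subst m c) k
          = Poly_Mapping.lookup c x * Poly_Mapping.lookup (m x) k"
        if c: "Poly_Mapping.keys c \<subseteq> X" for c
      proof -
        \<comment> \<open>\<open>x\<close> is inserted because it need not be a key of
          \<open>c\<close>; its term is 0 in that case.\<close>
        let ?I = "insert x (Poly_Mapping.keys c)"
        have "Poly_Mapping.lookup (m i) k = 0" if "i \<in> Poly_Mapping.keys c" "i \<noteq> x" for i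
          using disj[of i x] that subsetD[OF c] True k by (auto simp: in_keys_iff)
        then have "(\<Sum>i\<in>?I. Poly_Mapping.lookup c i * Poly_Mapping.lookup (m i) k)
            = (\<Sum>i\<in>?I. if i = x then Poly_Mapping.lookup c x * Poly_Mapping.lookup (m x) k else 0)"
          by (intro sum.cong) auto
        then show ?thesis
          by (simp add: monomial_subst_superset[of ?I] lookup_sum subset_insertI del: sum.insert)
      qed
      then show ?thesis using ab eq k by (simp add: in_keys_iff) (metis mult_cancel2 neq0_conv)
    next
      case False
      then show ?thesis using ab by (metis (mono_tags) in_keys_iff mem_Collect_eq subsetD)
    qed
  qed
qed

lemma subst_eq_monomial_sum: "subst A m = monomial_sum A (monomial_subst m)"
  unfolding subst_def monomial_subst_def[abs_def] ..

section \<open>Coefficients and products of sums of monomials\<close>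

lemma coeff_monomial_sum: "coeff (monomial_sum I m) u = int (card {i \<in> I. m i = u})"
  by (simp add: monomial_sum_def Abs_mfps_inverse)

text \<open>The coefficients are cardinalities of fibres of \<open>m\<close>, and these have at most
  one element.\<close>

lemma binary_monomial_sum:
  assumes inj: "inj_on m I"
  shows "binary_mfps (monomial_sum I m)"
proof -
  have "card {i \<in> I. m i = u} \<in> {0, 1}" for u
  proof (cases "\<exists>i\<in>I. m i = u")
    case True
    then obtain i where "i \<in> I" "m i = u" by blast
    then have "{i \<in> I. m i = u} = {i}" using inj by (auto simp: inj_on_def)
    then show ?thesis by simp
  qed (auto intro: card_eq_0_iff[THEN iffD2])
  then show ?thesis by (auto simp: binary_mfps_def coeff_monomial_sum)
qed

lemma inj_on_finite_fibre: "inj_on m I \<Longrightarrow> finite {i \<in> I. m i = u}"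
proof (rule finite_imageD[where f = m])
  have "m ` {i \<in> I. m i = u} \<subseteq> {u}" by auto
  then show "finite (m ` {i \<in> I. m i = u})" using finite_subset by blast
qed (auto simp: inj_on_def)

text \<open>The pairs \<open>(i, j)\<close> contributing to \<open>u\<close> are sorted by the
  splitting \<open>(m i, n j)\<close> of \<open>u\<close>. Finiteness of the fibres keeps
  \<open>card\<close> away from its default value 0 on infinite sets.\<close>

lemma monomial_sum_mult:
  fixes m :: "'i \<Rightarrow> ('v \<Rightarrow>\<^sub>0 nat)" and n :: "'j \<Rightarrow> ('v \<Rightarrow>\<^sub>0 nat)"
  assumes I: "\<And>u. finite {i \<in> I. m i = u}" and J: "\<And>u. finite {j \<in> J. n j = u}"
  shows "monomial_sum I m * monomial_sum J n = monomial_sum (I \<times> J) (\<lambda>(i, j). m i + n j)"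
proof (rule mfps_eqI)
  fix u
  let ?S = "{(a, b). a + b = (u :: 'v \<Rightarrow>\<^sub>0 nat)}"
  let ?F = "\<lambda>p. {i \<in> I. m i = fst p} \<times> {j \<in> J. n j = snd p}"
  have "{p \<in> I \<times> J. (case p of (i, j) \<Rightarrow> m i + n j) = u} = (\<Union>p\<in>?S. ?F p)"
    by auto
  moreover have "card (\<Union>p\<in>?S. ?F p) = (\<Sum>p\<in>?S. card (?F p))"
    using I J by (intro card_UN_disjoint finite_splittings) auto
  ultimately show "coeff (monomial_sum I m * monomial_sum J n) u
      = coeff (monomial_sum (I \<times> J) (\<lambda>(i, j). m i + n j)) u"
    by (simp add: times_mfps.rep_eq coeff_monomial_sum card_cartesian_product case_prod_beta)
qed

section \<open>Push-forward of power series\<close>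

text \<open>Extends substitution of monomials from series of sets to arbitrary power series. Over an
  infinite fibre the sum has the default value 0, which is why the rules below assume finite
  fibres.\<close>

definition push :: "(('w \<Rightarrow>\<^sub>0 nat) \<Rightarrow> ('v \<Rightarrow>\<^sub>0 nat)) \<Rightarrow> 'w mfps \<Rightarrow> 'v mfps" where
  "push h f = Abs_mfps (\<lambda>u. \<Sum>a \<in> {a. h a = u}. coeff f a)"

lemma coeff_push: "coeff (push h f) u = (\<Sum>a \<in> {a. h a = u}. coeff f a)"
  by (simp add: push_def Abs_mfps_inverse)

text \<open>Both sides add up \<open>coeff f b * coeff g c\<close> over all \<open>(b, c)\<close>
  with \<open>h (b + c) = u\<close>, grouped once by \<open>b + c\<close> and once by
  \<open>(h b, h c)\<close>.\<close>

lemma push_mult: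
  assumes h: "additive_exp h" and fin: "\<And>u. finite {a. h a = u}"
  shows "push h (f * g) = push h f * push h g"
proof (rule mfps_eqI)
  fix u
  let ?S = "\<lambda>u. {(a, b). a + b = u}"
  let ?G = "\<lambda>q. coeff f (fst q) * coeff g (snd q)"
  have "coeff (push h (f * g)) u = (\<Sum>a \<in> {a. h a = u}. \<Sum>q \<in> ?S a. ?G q)"
    by (simp add: coeff_push times_mfps.rep_eq case_prod_beta)
  also have "\<dots> = (\<Sum>(a, q) \<in> Sigma {a. h a = u} ?S. ?G q)"
    by (rule sum.Sigma) (auto intro: fin finite_splittings)
  also have "\<dots> = (\<Sum>(p, q) \<in> Sigma (?S u) (\<lambda>p. {a. h a = fst p} \<times> {a. h a = snd p}). ?G q)"
    by (rule sum.reindex_bij_witness[where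
          i = "\<lambda>(p, (b, c)). (b + c, (b, c))" and j = "\<lambda>(a, (b, c)). ((h b, h c), (b, c))"])
      (use h in \<open>auto simp: additive_exp_def\<close>)
  also have "\<dots> = (\<Sum>p \<in> ?S u. \<Sum>q \<in> {a. h a = fst p} \<times> {a. h a = snd p}. ?G q)"
    by (rule sum.Sigma[symmetric]) (auto intro: fin finite_splittings)
  also have "\<dots> = coeff (push h f * push h g) u"
    by (simp add: times_mfps.rep_eq case_prod_beta coeff_push sum_product sum.cartesian_product)
  finally show "coeff (push h (f * g)) u = coeff (push h f * push h g) u" .
qed

lemma push_one:
  assumes h: "additive_exp h" and fin: "\<And>u. finite {a. h a = u}"
  shows "push h 1 = 1"
proof (rule mfps_eqI)
  fix u
  have "(\<Sum>a \<in> {a. h a = u}. if a = 0 then 1 else 0) = (if u = 0 then 1 else (0 :: int))"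
    using h fin[of u] by (auto simp: additive_exp_def)
  then show "coeff (push h 1) u = coeff 1 u"
    by (simp add: coeff_push one_mfps.rep_eq)
qed

lemma push_power:
  assumes "additive_exp h" and "\<And>u. finite {a. h a = u}"
  shows "push h (f ^ k) = push h f ^ k"
  by (induction k) (simp_all add: push_one[OF assms] push_mult[OF assms])

lemma push_prod:
  assumes "additive_exp h" and "\<And>u. finite {a. h a = u}"
  shows "push h (prod f A) = (\<Prod>i\<in>A. push h (f i))"
  by (induction A rule: infinite_finite_induct)
    (simp_all add: push_one[OF assms] push_mult[OF assms])

lemma push_monomial_sum:
  assumes fin: "\<And>u. finite {a. h a = u}" and I: "\<And>u. finite {i \<in> I. m i = u}"
  shows "push h (monomial_sum I m) = monomial_sum I (\<lambda>i. h (m i))"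
proof (rule mfps_eqI)
  fix u
  have "{i \<in> I. h (m i) = u} = (\<Union>a \<in> {a. h a = u}. {i \<in> I. m i = a})"
    by auto
  moreover have "card (\<Union>a \<in> {a. h a = u}. {i \<in> I. m i = a})
      = (\<Sum>a \<in> {a. h a = u}. card {i \<in> I. m i = a})"
    using fin I by (intro card_UN_disjoint) auto
  ultimately show "coeff (push h (monomial_sum I m)) u = coeff (monomial_sum I (\<lambda>i. h (m i))) u"
    by (simp add: coeff_push coeff_monomial_sum)
qed

text \<open>Makes the ring homomorphism rules for \<open>push\<close> available for the factor
  \<open>subst T' (collapse W z X)\<close> of a generating step.\<close>

lemma push_series:
  assumes "\<And>u. finite {a. monomial_subst m a = u}"
  shows "push (monomial_subst m) (series A) = subst A m"
  unfolding series_def subst_eq_monomial_sum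
  by (rule push_monomial_sum) (auto simp: assms)

text \<open>Since \<open>m\<close> is nonzero, its multiples are pairwise different, so that
  \<open>subst1 C m\<close> is a sum with finite fibres.\<close>

lemma push_subst1:
  assumes "additive_exp h" and "\<And>u. finite {a. h a = u}" and "m \<noteq> 0"
  shows "push h (subst1 C m) = subst1 C (h m)"
proof -
  have "inj_on (\<lambda>c. scale c m) C" using inj_scale[OF assms(3)] inj_on_subset by blast
  then show ?thesis
    unfolding subst1_def
    by (subst push_monomial_sum)
      (use assms in \<open>auto intro: inj_on_finite_fibre simp: additive_exp_scale\<close>)
qed

lemma push_subst:
  assumes "additive_exp h" and "\<And>u. finite {a. h a = u}" and "inj_on (monomial_subst m) A"
  shows "push h (subst A m) = subst A (\<lambda>i. h (m i))"
  unfolding subst_eq_monomial_sum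
  by (subst push_monomial_sum)
    (use assms in \<open>auto intro: inj_on_finite_fibre simp: additive_exp_monomial_subst\<close>)

lemma subst_cong:
  assumes "\<And>a i. a \<in> A \<Longrightarrow> i \<in> Poly_Mapping.keys a \<Longrightarrow> m i = m' i"
  shows "subst A m = subst A m'"
proof -
  have "{a \<in> A. monomial_subst m a = u} = {a \<in> A. monomial_subst m' a = u}" for u
    using assms monomial_subst_cong by metis
  then show ?thesis by (simp add: subst_eq_monomial_sum monomial_sum_def)
qed

section \<open>The corner and the uniqueness of \<open>c b + e\<close>\<close>

lemma corner_keys: "e \<in> corner I a \<Longrightarrow> Poly_Mapping.keys e \<subseteq> I"
  by (auto simp: corner_def)

text \<open>If \<open>c < c'\<close>, cancelling \<open>c b\<close> exhibits \<open>e\<close> as a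
  vector of the shifted orthant, which the corner omits; by symmetry \<open>c = c'\<close>, and then
  \<open>e = e'\<close>.\<close>

lemma corner_decomposition_unique:
  fixes e e' :: "'v \<Rightarrow>\<^sub>0 nat"
  assumes I: "finite I" and e: "e \<in> corner I b" and e': "e' \<in> corner I b"
    and eq: "scale c (vector I b) + e = scale c' (vector I b) + e'"
  shows "c = c' \<and> e = e'"
proof -
  have not_less: "\<not> c < c'"
    if "e \<in> corner I b" "e' \<in> corner I b"
      "scale c (vector I b) + e = scale c' (vector I b) + e'" for c c' and e e' :: "'v \<Rightarrow>\<^sub>0 nat"
  proof
    assume "c < c'"
    \<comment> \<open>Writing the gap as \<open>d + 1\<close> lets one full copy of \<open>b\<close>
      be split off.\<close>
    then obtain d where d: "c' = c + (d + 1)" by (metis Suc_eq_plus1 add_Suc_right less_iff_Suc_add)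
    have "scale c (vector I b) + e
        = scale c (vector I b) + (e' + scale d (vector I b) + vector I b)"
      using that(3) unfolding d scale_add_left by (simp add: algebra_simps)
    then have "e = (e' + scale d (vector I b)) + vector I b" by simp
    moreover have "Poly_Mapping.keys (e' + scale d (vector I b)) \<subseteq> I"
      using subsetD[OF corner_keys[OF that(2)]] I
      by (auto simp: in_keys_iff lookup_add lookup_vector split: if_splits)
    ultimately show False using that(1) unfolding corner_def by blast
  qed
  have "c = c'" using not_less[OF e e' eq] not_less[OF e' e eq[symmetric]] by simp
  then show ?thesis using eq by simp
qed

text \<open>Writing \<open>x^(\<mu> v)\<close> as the image of \<open>x^b\<close>, uniqueness reduces to that of \<open>c b + e\<close> with
  \<open>e\<close> in the corner.\<close>

lemma binary_subst1_times_corner: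
  assumes I: "finite I" and inj: "inj_on (monomial_subst m) {a. Poly_Mapping.keys a \<subseteq> I}"
    and b: "vector I b \<noteq> 0" and \<delta>: "\<delta> \<in> {0, 1}"
  shows "binary_mfps (subst1 C (monomial_subst m (vector I b)) * subst (corner I b) m ^ \<delta>)"
proof -
  let ?h = "monomial_subst m"
  have add: "additive_exp ?h" by (rule additive_monomial_subst)
  have vec: "Poly_Mapping.keys (vector I b) \<subseteq> I"
    using I by (auto simp: in_keys_iff lookup_vector split: if_splits)
  \<comment> \<open>\<open>?h\<close> is injective on these vectors and sends 0 to 0.\<close>
  have "?h (vector I b) \<noteq> 0"
    using inj_onD[OF inj, of "vector I b" 0] b vec add by (auto simp: additive_exp_def)
  then have inj1: "inj_on (\<lambda>c. scale c (?h (vector I b))) C"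
    using inj_scale inj_on_subset by blast
  have inj2: "inj_on ?h (corner I b)"
    using inj by (rule inj_on_subset) (auto dest: corner_keys)
  have "inj_on (\<lambda>(c, e). scale c (?h (vector I b)) + ?h e) (C \<times> corner I b)"
  proof (rule inj_onI, clarsimp)
    fix c e c' e'
    assume e: "e \<in> corner I b" "e' \<in> corner I b"
      and "scale c (?h (vector I b)) + ?h e = scale c' (?h (vector I b)) + ?h e'"
    then have "?h (scale c (vector I b) + e) = ?h (scale c' (vector I b) + e')"
      by (simp add: additive_exp_add[OF add] additive_exp_scale[OF add])
    moreover have "Poly_Mapping.keys (scale d (vector I b) + f) \<subseteq> I" if "f \<in> corner I b" for d f
      using subsetD[OF corner_keys[OF that]] I
      by (auto simp: in_keys_iff lookup_add lookup_vector split: if_splits)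
    ultimately have "scale c (vector I b) + e = scale c' (vector I b) + e'"
      using inj_onD[OF inj] e by blast
    then show "c = c' \<and> e = e'" by (rule corner_decomposition_unique[OF I e])
  qed
  then have "binary_mfps (subst1 C (?h (vector I b)) * subst (corner I b) m)"
    unfolding subst1_def subst_eq_monomial_sum
    by (subst monomial_sum_mult)
      (auto intro: inj_on_finite_fibre inj1 inj2 binary_monomial_sum)
  \<comment> \<open>The case \<open>\<delta> = 0\<close>, in which the corner factor is 1.\<close>
  moreover have "binary_mfps (subst1 C (?h (vector I b)))"
    unfolding subst1_def by (rule binary_monomial_sum[OF inj1])
  ultimately show ?thesis using \<delta> by auto
qed

section \<open>Rooted trees and the map \<open>\<mu>\<close>\<close>

context
  fixes V :: "'v set" and \<Gamma> :: "('v \<times> 'v) set" and \<phi> :: 'v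
  assumes tree: "rooted_tree V \<Gamma> \<phi>"
begin

lemma tree_finite: "finite V" and tree_edges: "\<Gamma> \<subseteq> V \<times> V" and tree_root: "\<phi> \<in> V"
  and tree_reach: "v \<in> V \<Longrightarrow> (\<phi>, v) \<in> \<Gamma>\<^sup>*" and root_no_parent: "(u, \<phi>) \<notin> \<Gamma>"
  using tree unfolding rooted_tree_def by auto

lemma parent_unique: "(u, v) \<in> \<Gamma> \<Longrightarrow> (u', v) \<in> \<Gamma> \<Longrightarrow> u = u'"
  using tree unfolding rooted_tree_def by blast

lemma offspring_subset: "offspring \<Gamma> v \<subseteq> V" and finite_offspring: "finite (offspring \<Gamma> v)"
proof -
  show "offspring \<Gamma> v \<subseteq> V" using tree_edges by (auto simp: offspring_def)
  then show "finite (offspring \<Gamma> v)" using tree_finite finite_subset by blast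
qed

lemma finite_tops: "finite (tops V \<Gamma>)"
  using tree_finite by (simp add: tops_def)

text \<open>A cycle contains the parents of its nodes, hence all their ancestors, hence the root.\<close>

lemma no_cycle: "(v, v) \<notin> \<Gamma>\<^sup>+"
proof
  assume cyc: "(v, v) \<in> \<Gamma>\<^sup>+"
  then have "v \<in> V" using tree_edges trancl_subset_Sigma by blast
  then have "(\<phi>, v) \<in> \<Gamma>\<^sup>*" by (rule tree_reach)
  then show False using cyc
  proof (induction rule: rtrancl_induct)
    case base
    then show False using root_no_parent by (meson tranclD2)
  next
    case (step y w)
    obtain u where "(w, u) \<in> \<Gamma>\<^sup>*" "(u, w) \<in> \<Gamma>" using step.prems by (meson tranclD2)
    then have "(y, y) \<in> \<Gamma>\<^sup>+" using step.hyps(2) parent_unique by (metis rtrancl_into_trancl2)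
    then show False by (rule step.IH)
  qed
qed

text \<open>Provides induction from the tops towards the root: a claim about a node may use the
  claim for its offspring.\<close>

lemma wf_offspring: "wf (\<Gamma>\<inverse>)"
proof (rule finite_acyclic_wf_converse)
  show "finite \<Gamma>" using tree_edges tree_finite by (meson finite_SigmaI finite_subset)
  show "acyclic \<Gamma>" using no_cycle by (simp add: acyclic_def)
qed

text \<open>Parents being unique, the nodes above \<open>x\<close> form a chain, so \<open>w\<close>
  and \<open>w'\<close> are comparable. If one were strictly below the other, the path between them
  would end through its parent \<open>v\<close>, and \<open>v\<close> would lie on a cycle.\<close>

lemma sibling_eq:
  assumes v: "(v, w) \<in> \<Gamma>" "(v, w') \<in> \<Gamma>" and x: "(w, x) \<in> \<Gamma>\<^sup>*" "(w', x) \<in> \<Gamma>\<^sup>*"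
  shows "w = w'"
proof -
  have not_below: "(a, b) \<notin> \<Gamma>\<^sup>+" if "(v, a) \<in> \<Gamma>" "(v, b) \<in> \<Gamma>" for a b
  proof
    assume "(a, b) \<in> \<Gamma>\<^sup>+"
    then obtain u where "(a, u) \<in> \<Gamma>\<^sup>*" "(u, b) \<in> \<Gamma>" by (meson tranclD2)
    then have "(v, v) \<in> \<Gamma>\<^sup>+" using that parent_unique by (metis rtrancl_into_trancl2)
    then show False using no_cycle by blast
  qed
  have "single_valued (\<Gamma>\<inverse>)" using parent_unique by (auto simp: single_valued_def)
  then have "(w, w') \<in> (\<Gamma>\<inverse>)\<^sup>* \<or> (w', w) \<in> (\<Gamma>\<inverse>)\<^sup>*"
    by (rule single_valued_confluent) (use x in \<open>auto simp: rtrancl_converse\<close>)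
  then show ?thesis
    using not_below[OF v] not_below[OF v(2,1)] by (auto simp: rtrancl_converse rtrancl_eq_or_trancl)
qed

section \<open>Paths in the tree\<close>

lemma tree_path_Nil: "tree_path \<Gamma> v [] x \<longleftrightarrow> v = x"
  and tree_path_Cons: "tree_path \<Gamma> v (w # vs) x \<longleftrightarrow> (v, w) \<in> \<Gamma> \<and> tree_path \<Gamma> w vs x"
  by (auto simp: tree_path_def)

lemma tree_path_rtrancl: "tree_path \<Gamma> v vs x \<Longrightarrow> (v, x) \<in> \<Gamma>\<^sup>*"
  by (induction vs arbitrary: v)
    (auto simp: tree_path_Nil tree_path_Cons intro: converse_rtrancl_into_rtrancl)

lemma tree_path_exists: "(v, x) \<in> \<Gamma>\<^sup>* \<Longrightarrow> \<exists>vs. tree_path \<Gamma> v vs x"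
  by (induction rule: converse_rtrancl_induct) (metis tree_path_Nil, metis tree_path_Cons)

text \<open>Justifies the \<open>THE\<close> in \<open>mu_entry\<close>. Two nonempty paths start
  with the same offspring by \<open>sibling_eq\<close>; an empty and a nonempty path with equal ends
  would give a cycle.\<close>

lemma tree_path_unique: "tree_path \<Gamma> v vs x \<Longrightarrow> tree_path \<Gamma> v ws x \<Longrightarrow> vs = ws"
proof (induction vs arbitrary: v ws)
  case Nil
  show ?case
  proof (cases ws)
    case (Cons w ws')
    then have "(v, w) \<in> \<Gamma>" "(w, v) \<in> \<Gamma>\<^sup>*"
      using Nil by (auto simp: tree_path_Nil tree_path_Cons dest: tree_path_rtrancl)
    then show ?thesis using no_cycle by (metis rtrancl_into_trancl2)
  qed simp
next
  case (Cons w vs)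
  have w: "(v, w) \<in> \<Gamma>" "tree_path \<Gamma> w vs x" using Cons.prems by (auto simp: tree_path_Cons)
  show ?case
  proof (cases ws)
    case Nil
    then have "(w, v) \<in> \<Gamma>\<^sup>*" using Cons.prems w by (auto simp: tree_path_Nil dest: tree_path_rtrancl)
    then show ?thesis using w(1) no_cycle by (metis rtrancl_into_trancl2)
  next
    case (Cons w' ws')
    then have w': "(v, w') \<in> \<Gamma>" "tree_path \<Gamma> w' ws' x"
      using Cons.prems by (auto simp: tree_path_Cons)
    have "w = w'" using sibling_eq[OF w(1) w'(1)] w(2) w'(2) tree_path_rtrancl by blast
    then show ?thesis using Cons.IH w(2) w'(2) Cons by simp
  qed
qed

text \<open>Treats ancestors and the node itself alike: the empty path has product 1.\<close>

lemma mu_entry_path: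
  assumes "tree_path \<Gamma> v vs x"
  shows "mu_entry \<Gamma> W v x = prod_list (map (\<lambda>u. alpha W u * node_size W u) vs)"
proof (cases "(v, x) \<in> \<Gamma>\<^sup>+")
  case True
  have "(THE vs. tree_path \<Gamma> v vs x) = vs"
    using assms tree_path_unique by blast
  then show ?thesis using True by (simp add: mu_entry_def ancestor_def)
next
  case False
  then have "v = x" using tree_path_rtrancl[OF assms] by (auto simp: rtrancl_eq_or_trancl)
  then have "vs = []" using tree_path_unique[OF assms, of "[]"] by (simp add: tree_path_Nil)
  then show ?thesis using False \<open>v = x\<close> by (simp add: mu_entry_def ancestor_def)
qed

lemma mu_entry_eq_0: "(v, x) \<notin> \<Gamma>\<^sup>* \<Longrightarrow> mu_entry \<Gamma> W v x = 0"
  by (auto simp: mu_entry_def ancestor_def rtrancl_eq_or_trancl)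

text \<open>A path from \<open>v\<close> to \<open>x\<close> passes through exactly one offspring,
  whose factor is split off; by \<open>sibling_eq\<close> the other offspring do not reach
  \<open>x\<close> and contribute 0.\<close>

lemma mu_entry_rec:
  assumes "v \<noteq> x"
  shows "mu_entry \<Gamma> W v x
    = (\<Sum>w \<in> offspring \<Gamma> v. alpha W w * node_size W w * mu_entry \<Gamma> W w x)"
proof (cases "(v, x) \<in> \<Gamma>\<^sup>*")
  case True
  then obtain w where w: "(v, w) \<in> \<Gamma>" "(w, x) \<in> \<Gamma>\<^sup>*" using assms by (meson converse_rtranclE)
  then obtain ws where ws: "tree_path \<Gamma> w ws x" using tree_path_exists by blast
  have "mu_entry \<Gamma> W w' x = 0" if "w' \<in> offspring \<Gamma> v - {w}" for w'
    using that sibling_eq[OF w(1) _ w(2), of w'] by (intro mu_entry_eq_0) (auto simp: offspring_def)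
  then have "(\<Sum>w \<in> offspring \<Gamma> v. alpha W w * node_size W w * mu_entry \<Gamma> W w x)
      = (\<Sum>w \<in> {w}. alpha W w * node_size W w * mu_entry \<Gamma> W w x)"
    using w by (intro sum.mono_neutral_right finite_offspring) (auto simp: offspring_def)
  then show ?thesis
    using w(1) ws mu_entry_path[OF ws] mu_entry_path[of v "w # ws" x] by (simp add: tree_path_Cons)
next
  case False
  then have "(w, x) \<notin> \<Gamma>\<^sup>*" if "w \<in> offspring \<Gamma> v" for w
    using that by (auto simp: offspring_def intro: converse_rtrancl_into_rtrancl)
  then show ?thesis using False by (simp add: mu_entry_eq_0)
qed

lemma mu_top:
  assumes "v \<in> tops V \<Gamma>"
  shows "mu V \<Gamma> W v = var v"
proof (rule poly_mapping_eqI)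
  fix x
  have "mu_entry \<Gamma> W v x = (if v = x then 1 else 0)"
    using assms by (auto simp: mu_entry_def ancestor_def tops_def offspring_def dest: tranclD)
  then show "Poly_Mapping.lookup (mu V \<Gamma> W v) x = Poly_Mapping.lookup (var v) x"
    using assms by (auto simp: mu_def lookup_vector[OF finite_tops] lookup_single)
qed

lemma mu_rec:
  assumes "v \<notin> tops V \<Gamma>"
  shows "mu V \<Gamma> W v
    = (\<Sum>w \<in> offspring \<Gamma> v. scale (alpha W w * node_size W w) (mu V \<Gamma> W w))"
proof (rule poly_mapping_eqI)
  fix x
  show "Poly_Mapping.lookup (mu V \<Gamma> W v) x = Poly_Mapping.lookup
      (\<Sum>w \<in> offspring \<Gamma> v. scale (alpha W w * node_size W w) (mu V \<Gamma> W w)) x"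
  proof (cases "x \<in> tops V \<Gamma>")
    case True
    \<comment> \<open>The entry recursion applies since a top differs from the non-top
      \<open>v\<close>; outside the tops both sides vanish.\<close>
    then have "v \<noteq> x" using assms by blast
    then show ?thesis
      using mu_entry_rec[of v x W] True by (simp add: mu_def lookup_vector[OF finite_tops] lookup_sum)
  qed (simp add: mu_def lookup_vector[OF finite_tops] lookup_sum)
qed

lemma keys_mu: "x \<in> Poly_Mapping.keys (mu V \<Gamma> W v) \<Longrightarrow> (v, x) \<in> \<Gamma>\<^sup>*"
  using mu_entry_eq_0 by (force simp: mu_def in_keys_iff lookup_vector[OF finite_tops] split: if_splits)

text \<open>Presents \<open>x^(mu v)\<close> as the image of \<open>x^b\<close> under the very
  substitution that is applied to the corner at \<open>v\<close>, as
  \<open>binary_subst1_times_corner\<close> requires.\<close>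

lemma mu_eq_monomial_subst:
  assumes "v \<notin> tops V \<Gamma>"
  shows "mu V \<Gamma> W v = monomial_subst (\<lambda>z. scale (node_size W z) (mu V \<Gamma> W z))
    (vector (offspring \<Gamma> v) (alpha W))"
  by (simp add: mu_rec[OF assms] monomial_subst_vector scale_scale)

context
  fixes W :: "'v weight"
  assumes pos: "\<And>v. v \<in> V \<Longrightarrow> v \<noteq> \<phi> \<Longrightarrow> alpha W v > 0 \<and> node_size W v > 0"
begin

lemma offspring_pos: "w \<in> offspring \<Gamma> v \<Longrightarrow> alpha W w > 0 \<and> node_size W w > 0"
  using pos[of w] offspring_subset root_no_parent by (auto simp: offspring_def)

text \<open>A nonzero coordinate passes from an offspring to its parent, because the factors in
  \<open>mu_rec\<close> are positive.\<close>

lemma mu_nonzero: "v \<in> V \<Longrightarrow> mu V \<Gamma> W v \<noteq> 0"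
proof (induction v rule: wf_induct_rule[OF wf_offspring])
  case (1 v)
  show ?case
  proof (cases "v \<in> tops V \<Gamma>")
    case True
    then show ?thesis by (simp add: mu_top)
  next
    case False
    then obtain w where w: "w \<in> offspring \<Gamma> v" using 1(2) by (auto simp: tops_def)
    then have "mu V \<Gamma> W w \<noteq> 0" using 1(1)[of w] offspring_subset by (auto simp: offspring_def)
    then obtain x where x: "Poly_Mapping.lookup (mu V \<Gamma> W w) x \<noteq> 0"
      by (metis poly_mapping_eqI lookup_zero)
    then have "Poly_Mapping.lookup (mu V \<Gamma> W v) x \<noteq> 0"
      using w offspring_pos[OF w]
      by (auto simp: mu_rec[OF False] lookup_sum sum_eq_0_iff[OF finite_offspring])
    then show ?thesis by (metis lookup_zero)
  qed
qed

text \<open>The keys of \<open>mu\<close> at a node are tops reachable from it, and by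
  \<open>sibling_eq\<close> different siblings reach no common top.\<close>

lemma inj_on_monomial_subst_mu:
  "inj_on (monomial_subst (\<lambda>z. scale (node_size W z) (mu V \<Gamma> W z)))
     {a. Poly_Mapping.keys a \<subseteq> offspring \<Gamma> v}"
proof (rule inj_on_monomial_subst)
  fix w assume w: "w \<in> offspring \<Gamma> v"
  then have "mu V \<Gamma> W w \<noteq> 0" using mu_nonzero offspring_subset by blast
  then obtain x where "Poly_Mapping.lookup (mu V \<Gamma> W w) x \<noteq> 0"
    by (metis poly_mapping_eqI lookup_zero)
  then have "Poly_Mapping.lookup (scale (node_size W w) (mu V \<Gamma> W w)) x \<noteq> 0"
    using offspring_pos[OF w] by simp
  then show "scale (node_size W w) (mu V \<Gamma> W w) \<noteq> 0" by (metis lookup_zero)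
next
  fix w w' assume ww: "w \<in> offspring \<Gamma> v" "w' \<in> offspring \<Gamma> v" "w \<noteq> w'"
  have "Poly_Mapping.keys (scale c m) \<subseteq> Poly_Mapping.keys m" for c and m :: "'v \<Rightarrow>\<^sub>0 nat"
    by (auto simp: in_keys_iff)
  then show "Poly_Mapping.keys (scale (node_size W w) (mu V \<Gamma> W w)) \<inter>
      Poly_Mapping.keys (scale (node_size W w') (mu V \<Gamma> W w')) = {}"
    using ww sibling_eq[of v w w'] keys_mu[of _ W w] keys_mu[of _ W w']
    by (simp add: offspring_def) blast
qed

end

end

section \<open>The product formula\<close>

text \<open>The common shape of \<open>P_series\<close> and \<open>Q_series\<close>:
  \<open>C\<close> selects a component of the node pairs and \<open>d\<close> is the exponent of the
  corner, so each argument is given only once.\<close>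

definition node_series ::
  "'v set \<Rightarrow> ('v \<times> 'v) set \<Rightarrow> 'v weight \<Rightarrow> ('v \<Rightarrow> nat set) \<Rightarrow> ('v \<Rightarrow> nat) \<Rightarrow> 'v \<Rightarrow> 'v mfps" where
  "node_series V \<Gamma> W C d v =
     (if v \<in> tops V \<Gamma> then subst1 (C v) (var v)
      else subst1 (C v) (mu V \<Gamma> W v)
        * subst (corner (offspring \<Gamma> v) (alpha W)) (\<lambda>z. scale (node_size W z) (mu V \<Gamma> W z)) ^ d v)"

lemma P_series_eq: "P_series V \<Gamma> \<phi> W
    = node_series V \<Gamma> W (\<lambda>v. fst (node_pair \<phi> W v)) (delta W)"
  and Q_series_eq: "Q_series V \<Gamma> \<phi> W
    = node_series V \<Gamma> W (\<lambda>v. snd (node_pair \<phi> W v)) (\<lambda>v. 1 - delta W v)"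
  by (simp_all add: fun_eq_iff P_series_def Q_series_def node_series_def)

lemma binary_node_series:
  assumes tree: "rooted_tree V \<Gamma> \<phi>"
    and pos: "\<And>v. v \<in> V \<Longrightarrow> v \<noteq> \<phi> \<Longrightarrow> alpha W v > 0 \<and> node_size W v > 0"
    and v: "v \<in> V" and d: "v \<notin> tops V \<Gamma> \<Longrightarrow> d v \<in> {0, 1}"
  shows "binary_mfps (node_series V \<Gamma> W C d v)"
proof (cases "v \<in> tops V \<Gamma>")
  case True
  have "inj_on (\<lambda>c. scale c (var v)) (C v)"
    by (rule inj_on_subset[OF inj_scale]) simp_all
  then show ?thesis using True by (simp add: node_series_def subst1_def binary_monomial_sum)
next
  case False
  let ?b = "vector (offspring \<Gamma> v) (alpha W)"
  let ?m = "\<lambda>z. scale (node_size W z) (mu V \<Gamma> W z)"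
  have mu: "mu V \<Gamma> W v = monomial_subst ?m ?b"
    by (rule mu_eq_monomial_subst[OF tree False])
  \<comment> \<open>Otherwise its image \<open>mu V \<Gamma> W v\<close> would be 0.\<close>
  have "?b \<noteq> 0"
    using mu_nonzero[OF tree pos v] mu additive_monomial_subst[of ?m]
    by (auto simp: additive_exp_def)
  then have "binary_mfps (subst1 (C v) (monomial_subst ?m ?b)
      * subst (corner (offspring \<Gamma> v) (alpha W)) ?m ^ d v)"
    by (intro binary_subst1_times_corner finite_offspring[OF tree]
        inj_on_monomial_subst_mu[OF tree pos] d[OF False])
  then show ?thesis using False by (simp add: node_series_def mu)
qed

text \<open>The image bounds the argument: variables other than \<open>z\<close> are kept, and
  \<open>z\<close> is replaced by a monomial that contains every \<open>x\<close> in
  \<open>X\<close>.\<close>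

lemma finite_fibre_collapse:
  assumes X: "finite X" "X \<noteq> {}" and pos: "\<And>x. x \<in> X \<Longrightarrow> alpha W x > 0 \<and> node_size W x > 0"
  shows "finite {a. monomial_subst (collapse W z X) a = u}"
proof -
  obtain x where x: "x \<in> X" using X by blast
  \<comment> \<open>The added summand bounds the exponent of \<open>z\<close> by that of the chosen
    \<open>x\<close> in \<open>u\<close>.\<close>
  let ?w = "u + Poly_Mapping.single z (Poly_Mapping.lookup u x)"
  \<comment> \<open>If the monomial put for \<open>i\<close> contains \<open>k\<close>, then
    \<open>k\<close> occurs in the image at least as often as \<open>i\<close> in the
    argument.\<close>
  have le: "Poly_Mapping.lookup a i \<le> Poly_Mapping.lookup (monomial_subst m a) k"
    if "Poly_Mapping.lookup (m i) k \<ge> 1" for a i k and m :: "'a \<Rightarrow> ('a \<Rightarrow>\<^sub>0 nat)"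
  proof -
    have "Poly_Mapping.lookup a i \<le> Poly_Mapping.lookup a i * Poly_Mapping.lookup (m i) k"
      using that by simp
    also have "\<dots> \<le> (\<Sum>i\<in>insert i (Poly_Mapping.keys a).
        Poly_Mapping.lookup a i * Poly_Mapping.lookup (m i) k)"
      by (rule member_le_sum) auto
    also have "\<dots> = Poly_Mapping.lookup (monomial_subst m a) k"
      by (simp add: monomial_subst_superset[of "insert i (Poly_Mapping.keys a)"] lookup_sum
          subset_insertI del: sum.insert)
    finally show ?thesis .
  qed
  have "Poly_Mapping.lookup a k \<le> Poly_Mapping.lookup ?w k"
    if a: "monomial_subst (collapse W z X) a = u" for a k
  proof (cases "k = z")
    case True
    have "Poly_Mapping.lookup (collapse W z X z) x \<ge> 1"
      using pos[OF x] x by (simp add: collapse_def lookup_vector[OF X(1)])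
    then show ?thesis using le[of "collapse W z X" z x a] a True by (simp add: lookup_add)
  next
    case False
    then have "Poly_Mapping.lookup (collapse W z X k) k \<ge> 1" by (simp add: collapse_def)
    then show ?thesis using le[of "collapse W z X" k k a] a by (simp add: lookup_add)
  qed
  then show ?thesis
    by (intro finite_subset[OF _ finite_bounded_poly_mappings[of ?w]]) blast
qed

section \<open>Pruning the offspring \<open>X\<close> of \<open>z\<close>, all of them tops\<close>

context
  fixes V :: "'v set" and \<Gamma> :: "('v \<times> 'v) set" and \<phi> :: 'v and W :: "'v weight"
    and z :: 'v and X :: "'v set" and V' :: "'v set" and \<Gamma>' :: "('v \<times> 'v) set"
  assumes tree: "rooted_tree V \<Gamma> \<phi>"
    and z: "z \<in> V" and X: "X = offspring \<Gamma> z" "X \<noteq> {}" "X \<subseteq> tops V \<Gamma>"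
    and V': "V' = V - X" and \<Gamma>': "\<Gamma>' = \<Gamma> - {z} \<times> X"
begin

lemma z_pruned: "z \<in> V'" and z_not_top: "z \<notin> tops V \<Gamma>"
  using z X V' by (auto simp: tops_def)

lemma offspring_pruned: "v \<noteq> z \<Longrightarrow> offspring \<Gamma>' v = offspring \<Gamma> v"
  and offspring_pruned_z: "offspring \<Gamma>' z = {}"
  using X \<Gamma>' by (auto simp: offspring_def)

lemma tops_pruned: "v \<in> V' \<Longrightarrow> v \<in> tops V' \<Gamma>' \<longleftrightarrow> v = z \<or> v \<in> tops V \<Gamma>"
  using V' offspring_pruned offspring_pruned_z by (cases "v = z") (auto simp: tops_def)

lemma no_edge_from_X: "x \<in> X \<Longrightarrow> (x, y) \<notin> \<Gamma>"
  using X by (auto simp: tops_def offspring_def)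

text \<open>The removed nodes have \<open>z\<close> as their only parent.\<close>

lemma offspring_pruned_subset: "v \<noteq> z \<Longrightarrow> v \<in> V' \<Longrightarrow> offspring \<Gamma> v \<subseteq> V'"
  using offspring_subset[OF tree] parent_unique[OF tree, of v _ z] V' X
  by (auto simp: offspring_def)

lemma rooted_tree_pruned: "rooted_tree V' \<Gamma>' \<phi>"
proof -
  have "(\<phi>, v) \<in> \<Gamma>'\<^sup>*" if "v \<in> V'" for v
  proof -
    have "(\<phi>, v) \<in> \<Gamma>\<^sup>*" using tree_reach[OF tree] that V' by blast
    \<comment> \<open>No edge leaves a removed node, so a path from the root to a remaining node
      survives the pruning.\<close>
    then have "v \<notin> X \<longrightarrow> (\<phi>, v) \<in> \<Gamma>'\<^sup>*"
    proof (induction rule: rtrancl_induct)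
      case (step u w)
      show ?case
      proof
        assume "w \<notin> X"
        then have "(u, w) \<in> \<Gamma>'" using step.hyps \<Gamma>' by blast
        moreover have "u \<notin> X" using no_edge_from_X step.hyps by blast
        ultimately show "(\<phi>, w) \<in> \<Gamma>'\<^sup>*" using step.IH by (meson rtrancl.rtrancl_into_rtrancl)
      qed
    qed simp
    then show ?thesis using that V' by blast
  qed
  moreover have "\<phi> \<in> V'"
    using tree_root[OF tree] root_no_parent[OF tree] V' X by (auto simp: offspring_def)
  moreover have "\<Gamma>' \<subseteq> V' \<times> V'"
  proof clarify
    fix a b assume ab: "(a, b) \<in> \<Gamma>'"
    then have "(a, b) \<in> \<Gamma>" "a \<noteq> z \<or> b \<notin> X" using \<Gamma>' by auto
    moreover have "b \<notin> X"
      using calculation parent_unique[OF tree, of a b z] X by (auto simp: offspring_def)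
    ultimately show "a \<in> V' \<and> b \<in> V'"
      using tree_edges[OF tree] no_edge_from_X V' by blast
  qed
  moreover have "\<exists>!u. (u, v) \<in> \<Gamma>'" if v: "v \<in> V' - {\<phi>}" for v
  proof -
    have "\<exists>u. (u, v) \<in> \<Gamma>" using tree v V' unfolding rooted_tree_def by blast
    then obtain u where "(u, v) \<in> \<Gamma>'" using v by (auto simp: V' \<Gamma>')
    then show ?thesis using parent_unique[OF tree, of _ v] \<Gamma>' by (metis DiffD1)
  qed
  ultimately show ?thesis
    using tree_finite[OF tree] root_no_parent[OF tree] V' \<Gamma>' unfolding rooted_tree_def by blast
qed

lemma mu_z: "mu V \<Gamma> W z = vector X (\<lambda>x. alpha W x * node_size W x)"
proof -
  have "mu V \<Gamma> W x = var x" if "x \<in> offspring \<Gamma> z" for x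
    using that mu_top[OF tree] X by blast
  then show ?thesis
    using X(1) by (simp add: mu_rec[OF tree z_not_top] vector_def scale_single)
qed

text \<open>At \<open>z\<close>, a top of the pruned tree, the variable becomes
  \<open>mu V \<Gamma> W z\<close> by \<open>mu_z\<close>; the variables of other tops are kept.
  Elsewhere an additive map respects the recursion \<open>mu_rec\<close>, and both trees have the
  same offspring.\<close>

lemma collapse_mu:
  "v \<in> V' \<Longrightarrow> monomial_subst (collapse W z X) (mu V' \<Gamma>' W v) = mu V \<Gamma> W v"
proof (induction v rule: wf_induct_rule[OF wf_offspring[OF tree]])
  case (1 v)
  consider "v = z" | "v \<noteq> z" "v \<in> tops V \<Gamma>" | "v \<noteq> z" "v \<notin> tops V \<Gamma>" by blast
  then show ?case
  proof cases
    case 1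
    then show ?thesis
      using tops_pruned[OF z_pruned]
      by (simp add: mu_top[OF rooted_tree_pruned] mu_z) (simp add: collapse_def)
  next
    case 2
    then show ?thesis
      using tops_pruned[OF 1(2)]
      by (simp add: mu_top[OF rooted_tree_pruned] mu_top[OF tree]) (simp add: collapse_def)
  next
    case 3
    then have "v \<notin> tops V' \<Gamma>'" using tops_pruned[OF 1(2)] by blast
    moreover have "monomial_subst (collapse W z X) (mu V' \<Gamma>' W w) = mu V \<Gamma> W w"
      if "w \<in> offspring \<Gamma> v" for w
      using 1(1)[of w] offspring_pruned_subset[OF 3(1) 1(2)] that by (auto simp: offspring_def)
    ultimately show ?thesis
      by (simp add: mu_rec[OF rooted_tree_pruned] mu_rec[OF tree 3(2)] offspring_pruned[OF 3(1)]
          additive_exp_sum[OF additive_monomial_subst]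
          additive_exp_scale[OF additive_monomial_subst])
  qed
qed

text \<open>The push-forward along \<open>collapse\<close> is multiplicative and turns each factor
  of the pruned tree, except that of \<open>z\<close>, into the factor of the full tree. The corner
  completes the factor of \<open>z\<close>, and the product over \<open>X\<close> supplies the
  removed tops.\<close>

lemma series_step:
  assumes pos: "\<And>v. v \<in> V \<Longrightarrow> v \<noteq> \<phi> \<Longrightarrow> alpha W v > 0 \<and> node_size W v > 0"
    and T': "series T' = (\<Prod>v\<in>V'. node_series V' \<Gamma>' W C d v)"
    and T: "series T = (\<Prod>x \<in> X. subst1 (C x) (var x))
      * subst (corner X (alpha W)) (\<lambda>x. scale (node_size W x) (var x)) ^ d z
      * subst T' (collapse W z X)"
  shows "series T = (\<Prod>v\<in>V. node_series V \<Gamma> W C d v)"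
proof -
  let ?\<sigma> = "collapse W z X"
  let ?h = "monomial_subst ?\<sigma>"
  have pos': "\<And>v. v \<in> V' \<Longrightarrow> v \<noteq> \<phi> \<Longrightarrow> alpha W v > 0 \<and> node_size W v > 0"
    using pos V' by blast
  have finX: "finite X" using X(1) finite_offspring[OF tree] by simp
  have add: "additive_exp ?h" by (rule additive_monomial_subst)
  have fin: "finite {a. ?h a = u}" for u
    using finX X offspring_pos[OF tree pos] by (intro finite_fibre_collapse) auto
  note push_rules = push_subst1[OF add fin] push_mult[OF add fin] push_power[OF add fin]
  have push_v: "push ?h (node_series V' \<Gamma>' W C d v) = node_series V \<Gamma> W C d v"
    if v: "v \<in> V' - {z}" for v
  proof (cases "v \<in> tops V \<Gamma>")
    case True
    then show ?thesis
      using v tops_pruned[of v] by (simp add: node_series_def push_rules) (simp add: collapse_def)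
  next
    case False
    have mu_v: "?h (mu V' \<Gamma>' W v) = mu V \<Gamma> W v" using v collapse_mu by blast
    let ?m' = "\<lambda>w. scale (node_size W w) (mu V' \<Gamma>' W w)"
    have "inj_on (monomial_subst ?m') {a. Poly_Mapping.keys a \<subseteq> offspring \<Gamma>' v}"
      by (rule inj_on_monomial_subst_mu[OF rooted_tree_pruned pos'])
    then have "inj_on (monomial_subst ?m') (corner (offspring \<Gamma> v) (alpha W))"
      using v by (auto intro: inj_on_subset dest: corner_keys simp: offspring_pruned)
    then have "push ?h (subst (corner (offspring \<Gamma> v) (alpha W)) ?m')
        = subst (corner (offspring \<Gamma> v) (alpha W)) (\<lambda>w. ?h (?m' w))"
      by (rule push_subst[OF add fin])
    also have "\<dots> = subst (corner (offspring \<Gamma> v) (alpha W)) (\<lambda>w. scale (node_size W w) (mu V \<Gamma> W w))"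
    proof (rule subst_cong)
      fix a i assume "a \<in> corner (offspring \<Gamma> v) (alpha W)" "i \<in> Poly_Mapping.keys a"
      \<comment> \<open>Keys of corner elements are offspring of \<open>v\<close>; as
        \<open>v\<close> is not \<open>z\<close>, they survive the pruning and
        \<open>collapse_mu\<close> applies.\<close>
      then have "i \<in> V'" using corner_keys offspring_pruned_subset v by blast
      then show "?h (?m' i) = scale (node_size W i) (mu V \<Gamma> W i)"
        by (simp add: additive_exp_scale[OF add] collapse_mu)
    qed
    finally show ?thesis
      using v False tops_pruned[of v] mu_nonzero[OF rooted_tree_pruned pos', of v]
      by (simp add: node_series_def push_rules offspring_pruned mu_v)
  qed
  \<comment> \<open>As a top of the pruned tree, \<open>z\<close> has no corner factor
    there.\<close>
  have push_z: "push ?h (node_series V' \<Gamma>' W C d z) = subst1 (C z) (mu V \<Gamma> W z)"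
    using tops_pruned[OF z_pruned]
    by (simp add: node_series_def push_rules mu_z) (simp add: collapse_def)
  have corner_z: "subst (corner X (alpha W)) (\<lambda>x. scale (node_size W x) (var x))
      = subst (corner X (alpha W)) (\<lambda>x. scale (node_size W x) (mu V \<Gamma> W x))"
  proof (rule subst_cong)
    fix a i assume "a \<in> corner X (alpha W)" "i \<in> Poly_Mapping.keys a"
    then have "i \<in> tops V \<Gamma>" using corner_keys X(3) by blast
    then show "scale (node_size W i) (var i) = scale (node_size W i) (mu V \<Gamma> W i)"
      by (simp add: mu_top[OF tree])
  qed
  have series_z: "node_series V \<Gamma> W C d z
      = subst (corner X (alpha W)) (\<lambda>x. scale (node_size W x) (var x)) ^ d z
        * push ?h (node_series V' \<Gamma>' W C d z)"
    using z_not_top unfolding push_z corner_z by (simp add: node_series_def X(1) mult.commute)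
  have finV': "finite V'" using tree_finite[OF rooted_tree_pruned] .
  have "subst T' ?\<sigma> = (\<Prod>v\<in>V'. push ?h (node_series V' \<Gamma>' W C d v))"
    by (simp add: push_series[OF fin, symmetric] T' push_prod[OF add fin])
  also have "\<dots> = push ?h (node_series V' \<Gamma>' W C d z) * (\<Prod>v\<in>V' - {z}. node_series V \<Gamma> W C d v)"
    using z_pruned finV' push_v by (simp add: prod.remove)
  finally have "series T = (\<Prod>x \<in> X. subst1 (C x) (var x))
      * (node_series V \<Gamma> W C d z * (\<Prod>v\<in>V' - {z}. node_series V \<Gamma> W C d v))"
    using T by (simp add: series_z mult_ac)
  \<comment> \<open>The nodes of \<open>X\<close> are tops of the full tree, where
    \<open>node_series\<close> is \<open>subst1 (C x) (var x)\<close>.\<close>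
  also have "\<dots> = (\<Prod>x \<in> X. node_series V \<Gamma> W C d x) * (\<Prod>v\<in>V'. node_series V \<Gamma> W C d v)"
    using z_pruned finV' X(3) by (simp add: prod.remove[of V' z] node_series_def subset_iff)
  also have "\<dots> = (\<Prod>v\<in>V. node_series V \<Gamma> W C d v)"
    unfolding V' using X(1) offspring_subset[OF tree, of z]
    by (subst prod.subset_diff[OF _ tree_finite[OF tree], of X]) (simp_all add: mult.commute)
  finally show ?thesis .
qed

end

section \<open>Induction over the generating steps\<close>

lemma series_image_single: "series (Poly_Mapping.single v ` C) = subst1 C (var v)"
proof -
  have "card {c \<in> C. Poly_Mapping.single v c = u} = card {a \<in> Poly_Mapping.single v ` C. a = u}" for u
    by (rule bij_betw_same_card[of "Poly_Mapping.single v"]) (auto simp: bij_betw_def inj_on_def)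
  then show ?thesis
    unfolding series_def subst1_def monomial_sum_def scale_single mult_1_right by presburger
qed

lemma generates_series:
  assumes "generates \<phi> W V \<Gamma> T J" "rooted_tree V \<Gamma> \<phi>"
    and "\<And>v. v \<in> V \<Longrightarrow> v \<noteq> \<phi> \<Longrightarrow> alpha W v > 0 \<and> node_size W v > 0"
  shows "series T = (\<Prod>v\<in>V. P_series V \<Gamma> \<phi> W v) \<and> series J = (\<Prod>v\<in>V. Q_series V \<Gamma> \<phi> W v)"
  using assms
proof (induction rule: generates.induct)
  case root
  show ?case
    by (simp add: P_series_def Q_series_def node_pair_def tops_def offspring_def series_image_single)
next
  case (step z V X \<Gamma> T' J' T J)
  have IH: "series T' = (\<Prod>v\<in>V - X. P_series (V - X) (\<Gamma> - {z} \<times> X) \<phi> W v) \<and>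
      series J' = (\<Prod>v\<in>V - X. Q_series (V - X) (\<Gamma> - {z} \<times> X) \<phi> W v)"
    using step.IH rooted_tree_pruned[OF step.prems(1) step.hyps(1-4) refl refl] step.prems(2) by blast
  \<comment> \<open>Removed nodes have a parent and so differ from the root; their pair therefore
    comes from \<open>Phi\<close>.\<close>
  have "x \<noteq> \<phi>" if "x \<in> X" for x
    using that step.hyps(2) root_no_parent[OF step.prems(1)] by (auto simp: offspring_def)
  then have pair: "node_pair \<phi> W x = Phi W x" if "x \<in> X" for x
    using that by (simp add: node_pair_def)
  note step' = series_step[OF step.prems(1) step.hyps(1-4) refl refl step.prems(2)]
  show ?case
    unfolding P_series_eq Q_series_eq
    using IH[unfolded P_series_eq Q_series_eq] step.hyps(6,7) pair
    by (intro conjI step') simp_all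
qed

text \<open>The size is the number of sums \<open>c + d\<close>, hence determined by the pair, and
  \<open>THE\<close> returns it.\<close>

lemma interval_pair_node_size:
  assumes "interval_pair P"
  shows "pair_size P > 0"
proof -
  have card: "N = card ((\<lambda>(c, d). c + d) ` (fst P \<times> snd P))" if "interval_pair_of_size N P" for N
    using that by (auto simp: interval_pair_of_size_def bij_betw_def)
  obtain N where N: "interval_pair_of_size N P" using assms by (auto simp: interval_pair_def)
  have "pair_size P = N"
    unfolding pair_size_def using N card by (metis (mono_tags, lifting) the_equality)
  then show ?thesis using N by (simp add: interval_pair_of_size_def)
qed

theorem theorem9p1:
  fixes V :: "'v set" and \<Gamma> :: "('v \<times> 'v) set" and \<phi> :: 'v and W :: "'v weight"
    and T J :: "('v \<Rightarrow>\<^sub>0 nat) set"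
  assumes "weighted_tree V \<Gamma> \<phi> W"
    and "generates \<phi> W V \<Gamma> T J"
  shows "(\<forall>v \<in> V. binary_mfps (P_series V \<Gamma> \<phi> W v) \<and> binary_mfps (Q_series V \<Gamma> \<phi> W v)) \<and>
    series T = (\<Prod>v \<in> V. P_series V \<Gamma> \<phi> W v) \<and>
    series J = (\<Prod>v \<in> V. Q_series V \<Gamma> \<phi> W v)"
proof -
  have tree: "rooted_tree V \<Gamma> \<phi>" and weight: "tree_weight V \<Gamma> \<phi> W"
    using assms(1) by (auto simp: weighted_tree_def)
  have pos: "alpha W v > 0 \<and> node_size W v > 0" if "v \<in> V" "v \<noteq> \<phi>" for v
    using weight that interval_pair_node_size by (auto simp: tree_weight_def)
  have "delta W v \<in> {0, 1}" if "v \<in> V" "v \<notin> tops V \<Gamma>" for v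
    using weight that unfolding tree_weight_def by blast
  \<comment> \<open>With \<open>delta W v\<close> also \<open>1 - delta W v\<close> is 0 or 1, as
    the case of Q requires.\<close>
  then have "binary_mfps (P_series V \<Gamma> \<phi> W v) \<and> binary_mfps (Q_series V \<Gamma> \<phi> W v)"
    if "v \<in> V" for v
    unfolding P_series_eq Q_series_eq
    using that by (intro conjI binary_node_series[OF tree pos]) auto
  then show ?thesis using generates_series[OF assms(2) tree pos] by blast
qed

end
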